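(* Let $n\ge 1$ be an integer, let $(p_1,p_2)$ be uniformly distributed on $[0,1]^2$, and let $Y\mid p_1,p_2\sim \mathrm{Binomial}(n,p_1p_2)$. Then for each $y\in\{0,1,\ldots,n\}$ the posterior distribution of $(p_1,p_2)$ given $Y=y$ is exchangeable (invariant under swapping $p_1$ and $p_2$) and admits the following decomposition: (i) the conditional distribution of $p_1$ given $p_2$ and $Y=y$ is the weighted Beta distribution $\mathbb{B}(y+1,\,n-y+1,\,p_2)$; (ii) the marginal posterior density of $p_2$ given $Y=y$ is $$\pi(p_2\mid y)=\sum_{k=0}^{n-y} w_k\, f_{k+y+1,\;n-y-k+1}(p_2),$$ where $f_{a,b}$ denotes the density of the $\mathbb{B}(a,b,1)$ distribution (the standard Beta distribution with parameters $a,b$), and $(w_k)_{0\le k\le n-y}$ are probabilities (nonnegative and summing to $1$) with $w_k\propto (k+y+1)^{-1}$ for $k\in\{0,\ldots,n-y\}$.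
   Context: For $a>0$, $b>0$, $\lambda\in[0,1]$, the weighted Beta distribution $\mathbb{B}(a,b,\lambda)$ is the distribution on $(0,1)$ with density $$f(z)=\frac{1}{C(a,b,\lambda)}\,z^{a-1}(1-\lambda z)^{b-1}\,\mathbb{I}_{(0,1)}(z),\qquad C(a,b,\lambda)=\int_0^1 z^{a-1}(1-\lambda z)^{b-1}\,dz .$$ The case $\lambda=1$ is the standard Beta$(a,b)$ distribution. The posterior distribution of $(p_1,p_2)$ given $Y=y$ is the distribution on $(0,1)^2$ with density proportional to $(p_1p_2)^y(1-p_1p_2)^{n-y}$. *)

theory Defs
  imports "HOL-Probability.Probability"
begin

definition wbeta_const :: "real \<Rightarrow> real \<Rightarrow> real \<Rightarrow> real" where
  "wbeta_const a b l = (LBINT z:{0<..<1}. z powr (a - 1) * (1 - l * z) powr (b - 1))"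

definition wbeta_density :: "real \<Rightarrow> real \<Rightarrow> real \<Rightarrow> real \<Rightarrow> real" where
  "wbeta_density a b l z =
     1 / wbeta_const a b l * (z powr (a - 1) * (1 - l * z) powr (b - 1)) * indicator {0<..<1} z"

text \<open>The weighted Beta distribution; meaningful for \<open>a > 0\<close>, \<open>b > 0\<close> and \<open>0 \<le> l \<le> 1\<close>.\<close>

definition wbeta :: "real \<Rightarrow> real \<Rightarrow> real \<Rightarrow> real measure" where
  "wbeta a b l = density lborel (\<lambda>z. ennreal (wbeta_density a b l z))"

text \<open>\<open>K\<close> is a regular conditional distribution of the \<open>N\<close>-valued random variable \<open>X\<close> given the
  \<open>L\<close>-valued random variable \<open>Z\<close>: it is a probability kernel, and \<open>K (Z \<omega>) A\<close> is a version of the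
  conditional probability of \<open>X \<in> A\<close> given the sigma-algebra generated by \<open>Z\<close>.
  The kernel only has to be given on a set \<open>S\<close> in which \<open>Z\<close> lies almost surely, because families such as
  the binomial or the weighted Beta distributions make no sense for parameters outside \<open>[0,1]\<close>.\<close>

definition cond_distribution ::
  "'a measure \<Rightarrow> 'b measure \<Rightarrow> ('a \<Rightarrow> 'b) \<Rightarrow> 'c measure \<Rightarrow> ('a \<Rightarrow> 'c) \<Rightarrow> 'c set \<Rightarrow> ('c \<Rightarrow> 'b measure) \<Rightarrow> bool"
where
  "cond_distribution M N X L Z S K \<longleftrightarrow>
     X \<in> measurable M N \<and> Z \<in> measurable M L \<and>
     (AE \<omega> in M. Z \<omega> \<in> S) \<and>
     K \<in> measurable (restrict_space L S) (prob_algebra N) \<and>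
     (\<forall>A\<in>sets N. AE \<omega> in M.
        real_cond_exp M (vimage_algebra (space M) Z L) (indicator (X -` A \<inter> space M)) \<omega>
          = measure (K (Z \<omega>)) A)"

text \<open>The posterior is the law of the parameter \<open>P\<close> under \<open>M\<close> conditioned on the event \<open>Y = y\<close>;
  \<^const>\<open>uniform_measure\<close> is the library's elementary conditioning on an event of positive probability.\<close>

definition posterior ::
  "'a measure \<Rightarrow> ('a \<Rightarrow> real \<times> real) \<Rightarrow> ('a \<Rightarrow> nat) \<Rightarrow> nat \<Rightarrow> (real \<times> real) measure" where
  "posterior M P Y y = distr (uniform_measure M {\<omega> \<in> space M. Y \<omega> = y}) borel P"

definition posterior_kernel :: "nat \<Rightarrow> nat \<Rightarrow> real \<times> real \<Rightarrow> real" where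
  "posterior_kernel n y = (\<lambda>(p1, p2).
     (p1 * p2) ^ y * (1 - p1 * p2) ^ (n - y) * indicator ({0<..<1} \<times> {0<..<1}) (p1, p2))"

definition posterior_density :: "nat \<Rightarrow> nat \<Rightarrow> real \<times> real \<Rightarrow> real" where
  "posterior_density n y p = posterior_kernel n y p / (\<integral>q. posterior_kernel n y q \<partial>lborel)"

end

theory Submission
  imports Defs
begin

text \<open>By Bayes' rule the posterior density is a multiple of \<open>(p1 * p2)^y * (1 - p1 * p2)^(n - y)\<close>, which
  is symmetric and, as a function of \<open>p1\<close>, a multiple of the weighted Beta density with \<open>\<lambda> = p2\<close>.
  Integrating \<open>p1\<close> out leaves \<open>p2^y * C(y + 1, n - y + 1, p2)\<close>, an incomplete Beta integral divided by
  \<open>p2\<close>. That integral is a binomial tail probability, and dividing its \<open>k\<close>-th term by \<open>p2\<close> gives the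
  \<open>k\<close>-th Beta density up to the factor \<open>1 / (k + y + 1)\<close>.\<close>

section \<open>Weighted Beta integrals with integer parameters\<close>

text \<open>For \<open>0 \<le> u \<le> 1\<close> this is the probability of strictly more than
  \<open>m\<close> successes in \<open>n\<close> trials. As a polynomial it is differentiable at
  every real \<open>u\<close>.\<close>

definition binomial_tail :: "nat \<Rightarrow> nat \<Rightarrow> real \<Rightarrow> real" where
  "binomial_tail n m u = (\<Sum>j=Suc m..n. real (n choose j) * u ^ j * (1 - u) ^ (n - j))"

text \<open>Differentiating the sum termwise telescopes: each summand contributes a difference of
  two consecutive binomial terms, and only the lowest one survives. The induction runs downwards
  from \<open>m = n\<close>, where the tail is a single power, and peels off the lowest
  summand.\<close>

lemma binomial_tail_has_derivative:
  assumes "m \<le> n"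
  shows "(binomial_tail (Suc n) m has_real_derivative
           real (Suc n) * real (n choose m) * u ^ m * (1 - u) ^ (n - m)) (at u)"
  using assms
proof (induction m rule: inc_induct)
  case base
  have "binomial_tail (Suc n) n = (\<lambda>u. u ^ Suc n)"
    by (simp add: binomial_tail_def fun_eq_iff)
  then show ?case
    using DERIV_pow[of "Suc n" u UNIV] by simp
next
  case (step m)
  have split: "binomial_tail (Suc n) m =
      (\<lambda>u. real (Suc n choose Suc m) * u ^ Suc m * (1 - u) ^ (n - m) + binomial_tail (Suc n) (Suc m) u)"
    using \<open>m < n\<close> by (simp add: binomial_tail_def fun_eq_iff sum.atLeast_Suc_atMost del: binomial_Suc_Suc)
  define q where "q = n - Suc m"
  have q: "n - m = Suc q"
    using \<open>m < n\<close> by (simp add: q_def)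
  \<comment> \<open>The two absorption identities rewrite the coefficients that the product rule
    produces from the peeled summand.\<close>
  have "real (Suc m) * real (Suc n choose Suc m) = real (Suc n) * real (n choose m)"
    using Suc_times_binomial_eq[of n m] by (metis mult.commute of_nat_mult)
  moreover have "real (Suc q) * real (Suc n choose Suc m) = real (Suc n) * real (n choose Suc m)"
    using binomial_absorb_comp[of "Suc n" "Suc m"] q by (metis diff_Suc_1 diff_Suc_Suc of_nat_mult)
  \<comment> \<open>The first two summands on the right are the derivative of the peeled summand,
    the third is the derivative given by the induction hypothesis; the last two cancel.\<close>
  ultimately have eq: "real (Suc n) * real (n choose m) * u ^ m * (1 - u) ^ (n - m) =
      (real (Suc m) * real (Suc n choose Suc m)) * u ^ m * (1 - u) ^ Suc q
       - (real (Suc q) * real (Suc n choose Suc m)) * u ^ Suc m * (1 - u) ^ q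
       + real (Suc n) * real (n choose Suc m) * u ^ Suc m * (1 - u) ^ q"
    by (simp add: q)
  show ?case
    unfolding split eq using step.IH unfolding q q_def[symmetric]
    by (auto intro!: derivative_eq_intros simp del: binomial_Suc_Suc of_nat_Suc power_Suc simp: algebra_simps)
qed

text \<open>On the open interval both bases are positive, even for \<open>l = 1\<close>, so
  \<open>powr\<close> agrees with natural powers. Adding the two null endpoints gives the closed
  interval required by the fundamental theorem of calculus.\<close>

lemma wbeta_const_conv_integral:
  assumes "0 \<le> l" "l \<le> 1"
  shows "wbeta_const (real m + 1) (real q + 1) l = (\<integral>x. (x ^ m * (1 - l * x) ^ q) * indicator {0..1} x \<partial>lborel)"
  unfolding wbeta_const_def set_lebesgue_integral_def
proof (intro integral_cong_AE)
  show "AE x in lborel. indicator {0<..<1} x *\<^sub>R (x powr (real m + 1 - 1) * (1 - l * x) powr (real q + 1 - 1)) =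
          x ^ m * (1 - l * x) ^ q * indicator {0..1} x"
    using AE_lborel_singleton[of "0::real"] AE_lborel_singleton[of "1::real"]
  proof eventually_elim
    case (elim x)
    show ?case
    proof (cases "x \<in> {0<..<1}")
      case True
      then have "l * x < 1"
        using assms by (intro le_less_trans[OF mult_left_le_one_le[of x l]]) auto
      then show ?thesis
        using True by (simp add: powr_realpow)
    qed (use elim in auto)
  qed
qed simp_all

text \<open>The factor \<open>l ^ m\<close> makes the integrand a function of \<open>l * x\<close>
  alone, namely a multiple of the derivative of a binomial tail at that point.\<close>

lemma wbeta_const_eq_binomial_tail:
  assumes "0 < l" "l \<le> 1"
  shows "l ^ m * wbeta_const (real m + 1) (real q + 1) l =
           binomial_tail (Suc (m + q)) m l / (l * real (Suc (m + q)) * real ((m + q) choose m))"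
proof -
  \<comment> \<open>The divisor \<open>l\<close> cancels the inner derivative of
    \<open>l * x\<close>; the other two factors cancel the constant in the derivative of the
    tail.\<close>
  define F where "F x = binomial_tail (Suc (m + q)) m (l * x) / (l * real (Suc (m + q)) * real ((m + q) choose m))" for x
  have F: "DERIV F x :> (l * x) ^ m * (1 - l * x) ^ q" for x
    unfolding F_def using assms
    by (auto intro!: derivative_eq_intros DERIV_chain2[OF binomial_tail_has_derivative]
             simp del: of_nat_Suc simp: field_simps)
  have "l ^ m * wbeta_const (real m + 1) (real q + 1) l =
      (\<integral>x. ((l * x) ^ m * (1 - l * x) ^ q) * indicator {0..1} x \<partial>lborel)"
    using assms by (subst wbeta_const_conv_integral) (auto simp flip: integral_mult_right_zero simp: power_mult_distrib mult_ac)
  also have "\<dots> = F 1 - F 0"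
    using F by (intro integral_FTC_Icc_real) (auto intro!: continuous_intros)
  also have "F 0 = 0"
    by (simp add: F_def binomial_tail_def)
  finally show ?thesis
    by (simp add: F_def)
qed

text \<open>This is the classical value \<open>m! q! / (m + q + 1)!\<close> of the Beta function. At
  \<open>u = 1\<close> only the top summand of the tail survives, since its factor
  \<open>(1 - u) ^ 0\<close> is 1.\<close>

lemma wbeta_const_one:
  "wbeta_const (real m + 1) (real q + 1) 1 = 1 / (real (Suc (m + q)) * real ((m + q) choose m))"
proof -
  have "binomial_tail (Suc (m + q)) m 1 = (\<Sum>j\<in>{Suc (m + q)}. 1)"
    unfolding binomial_tail_def by (intro sum.mono_neutral_cong_right) auto
  then show ?thesis
    using wbeta_const_eq_binomial_tail[of 1 m q] by simp
qed

section \<open>Positivity, measurability and normalisation\<close>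

lemma integrable_power_beta:
  assumes "0 \<le> l" "l \<le> 1"
  shows "integrable lborel (\<lambda>x::real. (x ^ m * (1 - l * x) ^ q) * indicator {0..1} x)"
  using borel_integrable_atLeastAtMost[of 0 1 "\<lambda>x::real. x ^ m * (1 - l * x) ^ q"]
  by (auto simp: mult_ac cong: if_cong simp: indicator_def if_distrib)

text \<open>The integrand decreases in \<open>l\<close>, so the explicit positive value at
  \<open>l = 1\<close> is a lower bound; this also covers \<open>l = 0\<close>.\<close>

lemma wbeta_const_pos:
  assumes "0 \<le> l" "l \<le> 1"
  shows "0 < wbeta_const (real m + 1) (real q + 1) l"
proof -
  have "0 < wbeta_const (real m + 1) (real q + 1) 1"
    by (simp add: wbeta_const_one del: of_nat_Suc)
  also have "\<dots> \<le> wbeta_const (real m + 1) (real q + 1) l"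
    using assms unfolding wbeta_const_conv_integral[OF assms] wbeta_const_conv_integral[OF zero_le_one order_refl]
    by (intro integral_mono integrable_power_beta)
       (auto simp: indicator_def mult_left_le_one_le intro!: mult_left_mono power_mono)
  finally show ?thesis .
qed

lemma wbeta_density_eq_power:
  assumes "0 \<le> l" "l \<le> 1" "x \<in> {0<..<1}"
  shows "wbeta_density (real m + 1) (real q + 1) l x =
           x ^ m * (1 - l * x) ^ q / wbeta_const (real m + 1) (real q + 1) l"
proof -
  have "l * x < 1"
    using assms by (intro le_less_trans[OF mult_left_le_one_le[of x l]]) auto
  then show ?thesis
    using assms by (simp add: wbeta_density_def powr_realpow)
qed

lemma wbeta_density_nonneg:
  assumes "0 \<le> l" "l \<le> 1"
  shows "0 \<le> wbeta_density (real m + 1) (real q + 1) l x"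
  using wbeta_const_pos[OF assms, of m q] by (simp add: wbeta_density_def)

lemma measurable_wbeta_const [measurable]: "wbeta_const a b \<in> borel_measurable borel"
  unfolding wbeta_const_def[abs_def] set_lebesgue_integral_def by measurable

lemma measurable_wbeta_density [measurable (raw)]:
  assumes [measurable]: "f \<in> borel_measurable M" "g \<in> borel_measurable M"
  shows "(\<lambda>\<omega>. wbeta_density a b (f \<omega>) (g \<omega>)) \<in> borel_measurable M"
  unfolding wbeta_density_def by measurable

lemma nn_integral_wbeta_density:
  assumes "0 \<le> l" "l \<le> 1"
  shows "(\<integral>\<^sup>+x. ennreal (wbeta_density (real m + 1) (real q + 1) l x) \<partial>lborel) = 1"
proof -
  let ?c = "wbeta_const (real m + 1) (real q + 1) l"
  have c: "0 < ?c"
    by (rule wbeta_const_pos[OF assms])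
  have "(\<integral>\<^sup>+x. ennreal (wbeta_density (real m + 1) (real q + 1) l x) \<partial>lborel)
      = (\<integral>\<^sup>+x. ennreal (((x ^ m * (1 - l * x) ^ q) * indicator {0..1} x) / ?c) \<partial>lborel)"
  proof (intro nn_integral_cong_AE)
    show "AE x in lborel. ennreal (wbeta_density (real m + 1) (real q + 1) l x) =
        ennreal (((x ^ m * (1 - l * x) ^ q) * indicator {0..1} x) / ?c)"
      using AE_lborel_singleton[of "0::real"] AE_lborel_singleton[of "1::real"]
    proof eventually_elim
      case (elim x)
      show ?case
      proof (cases "x \<in> {0<..<1}")
        case True
        then show ?thesis
          by (simp add: wbeta_density_eq_power[OF assms])
      qed (use elim in \<open>auto simp: wbeta_density_def\<close>)
    qed
  qed
  also have "\<dots> = ennreal (\<integral>x. ((x ^ m * (1 - l * x) ^ q) * indicator {0..1} x) / ?c \<partial>lborel)"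
    using c assms
    by (intro nn_integral_eq_integral AE_I2 integrable_divide integrable_power_beta)
       (auto simp: indicator_def mult_le_one)
  also have "\<dots> = 1"
    using c by (simp flip: wbeta_const_conv_integral[OF assms])
  finally show ?thesis .
qed

text \<open>With \<open>u = x * z\<close>, the integral over \<open>x\<close> is an incomplete Beta integral, that is, a tail of the
  binomial distribution with \<open>m + q + 1\<close> trials; its terms are multiples of Beta densities.\<close>

lemma wbeta_const_mixture:
  assumes z: "z \<in> {0<..<1}"
  shows "z ^ m * wbeta_const (real m + 1) (real q + 1) z =
    (\<Sum>k=0..q. inverse (real k + real m + 1) * wbeta_density (real (k + m) + 1) (real (q - k) + 1) 1 z)
      / (real (Suc (m + q)) * real ((m + q) choose m))"
proof -
  \<comment> \<open>The index shift is \<open>j = k + m + 1\<close>, so \<open>q - k\<close>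
    failures remain.\<close>
  have "binomial_tail (Suc (m + q)) m z =
      (\<Sum>k=0..q. real (Suc (m + q) choose Suc (k + m)) * z ^ Suc (k + m) * (1 - z) ^ (q - k))"
    unfolding binomial_tail_def
    by (rule sum.reindex_bij_witness[where i = "\<lambda>k. Suc (k + m)" and j = "\<lambda>j. j - Suc m"])
       (auto simp del: binomial_Suc_Suc power_Suc intro!: arg_cong2[of _ _ _ _ "(*)"] arg_cong2[of _ _ _ _ "(^)"])
  also have "\<dots> = z * (\<Sum>k=0..q. inverse (real k + real m + 1) *
      wbeta_density (real (k + m) + 1) (real (q - k) + 1) 1 z)"
    unfolding sum_distrib_left
  proof (intro sum.cong refl)
    fix k assume "k \<in> {0..q}"
    then have kq: "k + m + (q - k) = m + q"
      by simp
    \<comment> \<open>Absorption is the source of the weights: it splits off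
      \<open>1 / (k + m + 1)\<close>, and what remains is the reciprocal normalising constant of the
      \<open>k\<close>-th Beta density times a ratio of binomial coefficients that
      \<open>wbeta_const_one\<close> accounts for.\<close>
    have "real (Suc (k + m)) * real (Suc (m + q) choose Suc (k + m)) = real (Suc (m + q)) * real ((m + q) choose (k + m))"
      using Suc_times_binomial_eq[of "m + q" "k + m"] by (metis mult.commute of_nat_mult)
    moreover have "real (Suc (k + m)) = real k + real m + 1"
      by simp
    ultimately have "real (Suc (m + q) choose Suc (k + m)) =
        inverse (real k + real m + 1) * (real (Suc (m + q)) * real ((m + q) choose (k + m)))"
      by (simp add: field_simps del: binomial_Suc_Suc of_nat_Suc)
    then show "real (Suc (m + q) choose Suc (k + m)) * z ^ Suc (k + m) * (1 - z) ^ (q - k) =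
        z * (inverse (real k + real m + 1) * wbeta_density (real (k + m) + 1) (real (q - k) + 1) 1 z)"
      by (simp only: wbeta_density_eq_power[OF zero_le_one order_refl z] wbeta_const_one kq) simp
  qed
  finally show ?thesis
    using z by (subst wbeta_const_eq_binomial_tail) auto
qed

section \<open>Conditional distributions\<close>

text \<open>The event \<open>Z \<in> B\<close> belongs to the sigma-algebra generated by
  \<open>Z\<close>, so integrating the conditional probability over it gives the joint probability.
  This supplies the numerator of Bayes' rule.\<close>

lemma cond_distribution_joint:
  assumes "finite_measure M" and cond: "cond_distribution M N X L Z S K"
    and A: "A \<in> sets N" and B: "B \<in> sets L"
  shows "emeasure M ((X -` A \<inter> space M) \<inter> (Z -` B \<inter> space M)) =
    (\<integral>\<^sup>+\<omega>. ennreal (measure (K (Z \<omega>)) A) * indicator B (Z \<omega>) \<partial>M)"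
proof -
  interpret finite_measure M by fact
  have [measurable]: "X \<in> measurable M N" "Z \<in> measurable M L"
    using cond by (auto simp: cond_distribution_def)
  note [measurable] = A B
  define F where "F = vimage_algebra (space M) Z L"
  have "subalgebra M F"
    by (auto simp: subalgebra_def F_def sets_image_in_sets)
  then interpret finite_measure_subalgebra M F
    by unfold_locales
  have BF: "Z -` B \<inter> space M \<in> sets F"
    unfolding F_def by (rule in_vimage_algebra) fact
  let ?E = "X -` A \<inter> space M"
  let ?c = "real_cond_exp M F (indicator ?E)"
  have ae: "AE \<omega> in M. ?c \<omega> = measure (K (Z \<omega>)) A"
    using cond A by (auto simp: cond_distribution_def F_def)
  have int: "integrable M (indicator ?E :: 'a \<Rightarrow> real)"
    by (simp add: integrable_real_indicator less_top[symmetric])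
  have "measure M (?E \<inter> (Z -` B \<inter> space M)) = (\<integral>\<omega>\<in>Z -` B \<inter> space M. indicator ?E \<omega> \<partial>M)"
    by (simp add: set_lebesgue_integral_def flip: indicator_inter_arith) (simp add: Int_ac)
  also have "\<dots> = (\<integral>\<omega>. indicator (Z -` B \<inter> space M) \<omega> * ?c \<omega> \<partial>M)"
    using real_cond_exp_intA[OF int BF] by (simp add: set_lebesgue_integral_def)
  finally have "emeasure M (?E \<inter> (Z -` B \<inter> space M)) =
      ennreal (\<integral>\<omega>. indicator (Z -` B \<inter> space M) \<omega> * ?c \<omega> \<partial>M)"
    by (simp add: emeasure_eq_measure)
  also have "\<dots> = (\<integral>\<^sup>+\<omega>. ennreal (indicator (Z -` B \<inter> space M) \<omega> * ?c \<omega>) \<partial>M)"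
  proof (intro nn_integral_eq_integral[symmetric])
    show "integrable M (\<lambda>\<omega>. indicator (Z -` B \<inter> space M) \<omega> * ?c \<omega>)"
      using integrable_mult_indicator[OF _ real_cond_exp_int(1)[OF int], of "Z -` B \<inter> space M"] by simp
    show "AE \<omega> in M. 0 \<le> indicator (Z -` B \<inter> space M) \<omega> * ?c \<omega>"
      using ae by eventually_elim simp
  qed
  also have "\<dots> = (\<integral>\<^sup>+\<omega>. ennreal (measure (K (Z \<omega>)) A) * indicator B (Z \<omega>) \<partial>M)"
    using ae by (intro nn_integral_cong_AE) (auto simp: indicator_def)
  finally show ?thesis .
qed

section \<open>Disintegration of a factored joint density\<close>

text \<open>In such a factorisation \<open>h\<close> is the marginal density of the second
  coordinate and \<open>f z\<close> the conditional density of the first. Normalising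
  \<open>f z\<close> on \<open>S\<close> suffices because \<open>h\<close> vanishes
  elsewhere.\<close>

context
  fixes Q :: "(real \<times> real) measure" and S :: "real set"
    and f :: "real \<Rightarrow> real \<Rightarrow> ennreal" and h :: "real \<Rightarrow> ennreal"
  assumes prob: "prob_space Q"
    and Q: "Q = density lborel (\<lambda>(x, z). h z * f z x)"
    and f [measurable]: "(\<lambda>(z, x). f z x) \<in> borel_measurable (borel \<Otimes>\<^sub>M borel)"
    and h [measurable]: "h \<in> borel_measurable borel"
    and S: "S \<in> sets borel"
    and f_one: "\<And>z. z \<in> S \<Longrightarrow> (\<integral>\<^sup>+x. f z x \<partial>lborel) = 1"
    and h_zero: "\<And>z. z \<notin> S \<Longrightarrow> h z = 0"
begin

text \<open>Tonelli with the first coordinate innermost. Taking \<open>A = UNIV\<close> yields the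
  marginal; general \<open>A\<close> yields the conditional law.\<close>

lemma emeasure_density_factor:
  assumes A: "A \<in> sets borel" and B: "B \<in> sets borel"
  shows "emeasure Q (A \<times> B) = (\<integral>\<^sup>+z. h z * emeasure (density lborel (f z)) A * indicator B z \<partial>lborel)"
proof -
  note [measurable] = A B
  have "emeasure Q (A \<times> B) =
      (\<integral>\<^sup>+p. (case p of (x, z) \<Rightarrow> h z * f z x) * indicator (A \<times> B) p \<partial>(lborel \<Otimes>\<^sub>M lborel))"
    unfolding Q lborel_prod[symmetric] by (rule emeasure_density) measurable
  also have "\<dots> = (\<integral>\<^sup>+z. \<integral>\<^sup>+x. h z * f z x * indicator (A \<times> B) (x, z) \<partial>lborel \<partial>lborel)"
    by (subst lborel_pair.nn_integral_snd[symmetric]) auto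
  also have "\<dots> = (\<integral>\<^sup>+z. h z * emeasure (density lborel (f z)) A * indicator B z \<partial>lborel)"
  proof (intro nn_integral_cong)
    fix z :: real
    have [measurable]: "f z \<in> borel_measurable borel"
      using measurable_Pair2'[of z borel borel] measurable_compose[OF _ f] by fastforce
    have "(\<integral>\<^sup>+x. h z * f z x * indicator (A \<times> B) (x, z) \<partial>lborel) =
        (\<integral>\<^sup>+x. (h z * indicator B z) * (f z x * indicator A x) \<partial>lborel)"
      by (intro nn_integral_cong) (auto simp: indicator_def)
    also have "\<dots> = (h z * indicator B z) * emeasure (density lborel (f z)) A"
      by (simp add: nn_integral_cmult emeasure_density)
    finally show "(\<integral>\<^sup>+x. h z * f z x * indicator (A \<times> B) (x, z) \<partial>lborel) =
        h z * emeasure (density lborel (f z)) A * indicator B z"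
      by (simp only: mult_ac)
  qed
  finally show ?thesis .
qed

lemma prob_space_density_factor:
  assumes "z \<in> S"
  shows "prob_space (density lborel (f z))"
proof -
  have [measurable]: "f z \<in> borel_measurable borel"
    using measurable_Pair2'[of z borel borel] measurable_compose[OF _ f] by fastforce
  show ?thesis
    using f_one[OF assms] by (intro prob_spaceI) (simp add: emeasure_density)
qed

lemma distr_snd_density_factor: "distr Q lborel snd = density lborel h"
proof (rule measure_eqI)
  have [measurable_cong]: "sets Q = sets (borel \<Otimes>\<^sub>M borel)"
    by (simp add: Q flip: borel_prod)
  fix B assume "B \<in> sets (distr Q lborel snd)"
  then have B [measurable]: "B \<in> sets borel"
    by simp
  have "snd -` B \<inter> space Q = UNIV \<times> B"
    by (auto simp: Q)
  then have "emeasure (distr Q lborel snd) B = emeasure Q (UNIV \<times> B)"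
    by (subst emeasure_distr) auto
  also have "\<dots> = (\<integral>\<^sup>+z. h z * emeasure (density lborel (f z)) UNIV * indicator B z \<partial>lborel)"
    by (rule emeasure_density_factor) auto
  also have "\<dots> = (\<integral>\<^sup>+z. h z * indicator B z \<partial>lborel)"
  proof (intro nn_integral_cong)
    fix z
    show "h z * emeasure (density lborel (f z)) UNIV * indicator B z = h z * indicator B z"
      using prob_space.emeasure_space_1[OF prob_space_density_factor[of z]] h_zero[of z]
      by (cases "z \<in> S") auto
  qed
  finally show "emeasure (distr Q lborel snd) B = emeasure (density lborel h) B"
    by (simp add: emeasure_density)
qed simp

text \<open>A conditional expectation is characterised by its integrals over the sets of the
  conditioning sigma-algebra. These sets are the preimages of Borel sets \<open>B\<close> under
  \<open>snd\<close>, and both integrals over such a set equal the mass of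
  \<open>A \<times> B\<close>.\<close>

lemma cond_distribution_density_factor:
  "cond_distribution Q borel fst borel snd S (\<lambda>z. density lborel (f z))"
  unfolding cond_distribution_def
proof (intro conjI ballI)
  interpret prob_space Q by (rule prob)
  have [measurable_cong]: "sets Q = sets (borel \<Otimes>\<^sub>M borel)"
    by (simp add: Q flip: borel_prod)
  have space_Q: "space Q = UNIV"
    by (simp add: Q)
  show "fst \<in> borel_measurable Q" and snd: "snd \<in> borel_measurable Q"
    by measurable
  have snd_lborel: "snd \<in> measurable Q lborel"
    by measurable
  have "AE z in density lborel h. z \<in> S"
    using h_zero by (subst AE_density) (force intro!: AE_I2)+
  then show AE_S: "AE p in Q. snd p \<in> S"
    unfolding distr_snd_density_factor[symmetric]
    using S by (subst (asm) AE_distr_iff[OF snd_lborel]) auto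
  have meas: "(\<lambda>z. emeasure (density lborel (f z)) A) \<in> borel_measurable borel"
    if [measurable]: "A \<in> sets borel" for A
  proof -
    have "(\<lambda>z. \<integral>\<^sup>+x. f z x * indicator A x \<partial>lborel) \<in> borel_measurable borel"
      by measurable
    moreover have "f z \<in> borel_measurable borel" for z
      using measurable_Pair2'[of z borel borel] measurable_compose[OF _ f] by fastforce
    ultimately show ?thesis
      by (simp add: emeasure_density)
  qed
  show "(\<lambda>z. density lborel (f z)) \<in> measurable (restrict_space borel S) (prob_algebra borel)"
    using prob_space_density_factor meas
    by (intro measurable_prob_algebraI measurable_subprob_algebra)
       (auto simp: space_restrict_space prob_space_imp_subprob_space intro!: measurable_restrict_space1)
  fix A :: "real set" assume A: "A \<in> sets borel"
  note [measurable] = A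
  \<comment> \<open>Outside \<open>S\<close> the kernel need not consist of probability measures.
    Cutting it off there makes \<open>g\<close> bounded by 1, hence integrable, and changes nothing
    almost surely.\<close>
  define g where "g z = indicator S z * measure (density lborel (f z)) A" for z
  have [measurable]: "g \<in> borel_measurable borel"
    unfolding g_def measure_def using S meas[OF A] by measurable
  have g_bound: "0 \<le> g z" "g z \<le> 1" for z
    using prob_space.prob_le_1[OF prob_space_density_factor[of z]] by (auto simp: g_def indicator_def)
  have g_eq: "h z * emeasure (density lborel (f z)) A = h z * ennreal (g z)" for z
  proof (cases "z \<in> S")
    case True
    then interpret D: prob_space "density lborel (f z)"
      by (rule prob_space_density_factor)
    show ?thesis
      using True by (simp add: g_def D.emeasure_eq_measure)
  qed (simp add: h_zero)
  define F where "F = vimage_algebra (space Q) snd (borel :: real measure)"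
  have "subalgebra Q F"
    using sets_image_in_sets[OF refl snd] by (simp add: subalgebra_def F_def)
  then interpret finite_measure_subalgebra Q F
    by unfold_locales
  let ?E = "fst -` A \<inter> space Q"
  have [measurable]: "?E \<in> sets Q"
    by measurable
  have "AE p in Q. real_cond_exp Q F (indicator ?E) p = g (snd p)"
  proof (rule real_cond_exp_charact)
    show "integrable Q (indicator ?E :: real \<times> real \<Rightarrow> real)"
      by (simp add: integrable_real_indicator less_top[symmetric])
    show int_g: "integrable Q (\<lambda>p. g (snd p))"
      using g_bound by (intro integrable_const_bound[of _ 1]) auto
    show "(\<lambda>p. g (snd p)) \<in> borel_measurable F"
      unfolding F_def by (rule measurable_compose[OF measurable_vimage_algebra1]) auto
    fix C assume "C \<in> sets F"
    then obtain B where B: "B \<in> sets borel" and C: "C = snd -` B \<inter> space Q"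
      by (auto simp: F_def sets_vimage_algebra2)
    note [measurable] = B
    have C_meas [measurable]: "C \<in> sets Q"
      unfolding C by measurable
    \<comment> \<open>The comparison is made in \<open>ennreal\<close>, where Tonelli and the change
      of measure apply directly; nonnegativity of both integrals brings it back to the
      reals.\<close>
    have "ennreal (\<integral>p\<in>C. indicator ?E p \<partial>Q) = ennreal (measure Q (C \<inter> ?E))"
      by (simp add: set_lebesgue_integral_def flip: indicator_inter_arith)
    also have "\<dots> = emeasure Q (A \<times> B)"
      unfolding emeasure_eq_measure[symmetric]
      by (intro arg_cong2[where f=emeasure]) (auto simp: C space_Q)
    also have "\<dots> = (\<integral>\<^sup>+z. h z * (ennreal (g z) * indicator B z) \<partial>lborel)"
      unfolding emeasure_density_factor[OF A B] g_eq by (simp add: mult_ac)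
    also have "\<dots> = (\<integral>\<^sup>+z. ennreal (g z) * indicator B z \<partial>density lborel h)"
      by (subst nn_integral_density) auto
    also have "\<dots> = (\<integral>\<^sup>+p. ennreal (g (snd p)) * indicator B (snd p) \<partial>Q)"
      unfolding distr_snd_density_factor[symmetric] by (rule nn_integral_distr) measurable
    also have "\<dots> = (\<integral>\<^sup>+p. ennreal (indicator C p * g (snd p)) \<partial>Q)"
      by (intro nn_integral_cong) (auto simp: C space_Q indicator_def)
    also have "\<dots> = ennreal (\<integral>p\<in>C. g (snd p) \<partial>Q)"
      unfolding set_lebesgue_integral_def real_scaleR_def
      using integrable_mult_indicator[OF C_meas int_g] g_bound
      by (intro nn_integral_eq_integral) auto
    finally have "ennreal (\<integral>p\<in>C. indicator ?E p \<partial>Q) = ennreal (\<integral>p\<in>C. g (snd p) \<partial>Q)" .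
    then show "(\<integral>p\<in>C. indicator ?E p \<partial>Q) = (\<integral>p\<in>C. g (snd p) \<partial>Q)"
      using g_bound unfolding set_lebesgue_integral_def
      by (subst (asm) ennreal_inj) (auto intro!: integral_nonneg_AE)
  qed
  then show "AE p in Q. real_cond_exp Q (vimage_algebra (space Q) snd borel) (indicator ?E) p =
      measure (density lborel (f (snd p))) A"
    using AE_S unfolding F_def by eventually_elim (simp add: g_def)
qed

end

section \<open>The posterior\<close>

lemma posterior_kernel_nonneg: "0 \<le> posterior_kernel n y p"
  by (cases p) (auto simp: posterior_kernel_def mult_le_one split: split_indicator)

lemma posterior_kernel_le_indicator: "posterior_kernel n y p \<le> indicator ({0<..<1} \<times> {0<..<1}) p"
  by (cases p) (auto simp: posterior_kernel_def mult_le_one power_le_one intro!: mult_le_one split: split_indicator)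

lemma posterior_kernel_pos:
  assumes "p \<in> {0<..<1} \<times> {0<..<1}"
  shows "0 < posterior_kernel n y p"
proof -
  obtain a b where "p = (a, b)" "0 < a" "a < 1" "0 < b" "b < 1"
    using assms by auto
  moreover then have "a * b < 1"
    using mult_strict_mono[of a 1 b 1] by simp
  ultimately show ?thesis
    by (simp add: posterior_kernel_def)
qed

lemma measurable_posterior_kernel [measurable]: "posterior_kernel n y \<in> borel_measurable borel"
  unfolding posterior_kernel_def borel_prod[symmetric] by measurable

lemma emeasure_unit_square: "emeasure lborel ({0<..<1} \<times> {0<..<1::real} :: (real \<times> real) set) = 1"
  unfolding lborel_prod[symmetric] by (subst lborel.emeasure_pair_measure_Times) auto

lemma integrable_posterior_kernel: "integrable lborel (posterior_kernel n y)"
proof (rule Bochner_Integration.integrable_bound)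
  show "integrable lborel (indicator ({0<..<1} \<times> {0<..<1}) :: real \<times> real \<Rightarrow> real)"
    by (intro integrable_real_indicator) (auto simp: emeasure_unit_square borel_prod[symmetric])
qed (use posterior_kernel_nonneg posterior_kernel_le_indicator in \<open>auto intro!: AE_I2\<close>)

text \<open>A nonnegative integrable function with integral zero vanishes almost everywhere, but the
  kernel is positive on the open square, which has measure 1.\<close>

lemma integral_posterior_kernel_pos: "0 < (\<integral>q. posterior_kernel n y q \<partial>lborel)"
proof -
  have "(\<integral>q. posterior_kernel n y q \<partial>lborel) \<noteq> 0"
  proof
    assume "(\<integral>q. posterior_kernel n y q \<partial>lborel) = 0"
    then have "AE q in lborel. posterior_kernel n y q = 0"
      using integral_nonneg_eq_0_iff_AE[OF integrable_posterior_kernel[of n y]] posterior_kernel_nonneg by auto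
    then have "AE q in lborel. q \<notin> ({0<..<1} \<times> {0<..<1::real} :: (real \<times> real) set)"
      by eventually_elim (metis less_irrefl posterior_kernel_pos)
    then have "emeasure lborel ({0<..<1} \<times> {0<..<1::real} :: (real \<times> real) set) = 0"
      by (subst (asm) AE_iff_null_sets[symmetric]) (auto simp: borel_prod[symmetric])
    then show False
      by (simp add: emeasure_unit_square)
  qed
  then show ?thesis
    using Bochner_Integration.integral_nonneg[of lborel "posterior_kernel n y"] posterior_kernel_nonneg
    by (simp add: order.strict_iff_order)
qed

text \<open>The boundary lies on four axis-parallel lines, each a null set. This reconciles the
  prior on the closed square with the kernel, which is supported on the open one.\<close>

lemma AE_unit_square_interior:
  "AE p in lborel. p \<in> {0..1} \<times> {0..1} \<longrightarrow> p \<in> {0<..<1::real} \<times> {0<..<1::real}"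
proof -
  have [simp]: "(1, 0) \<in> (Basis :: (real \<times> real) set)" "(0, 1) \<in> (Basis :: (real \<times> real) set)"
    by (auto simp: Basis_prod_def)
  have ae: "AE p in lborel. p \<bullet> (1::real, 0::real) \<noteq> 0 \<and> p \<bullet> (1::real, 0::real) \<noteq> 1 \<and>
      p \<bullet> (0::real, 1::real) \<noteq> 0 \<and> p \<bullet> (0::real, 1::real) \<noteq> 1"
    by (intro AE_conjI AE_lborel_inner_neq) simp_all
  show ?thesis
    using ae by eventually_elim (auto simp: less_le)
qed

section \<open>Bayes' rule\<close>

text \<open>The joint probability of \<open>Y = y\<close> and \<open>P \<in> B\<close> is the
  binomial coefficient times the kernel's integral over \<open>B\<close>. Dividing by the case
  \<open>B = UNIV\<close> cancels the coefficient and leaves the normalised kernel.\<close>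

lemma posterior_eq_density:
  fixes M :: "'a measure" and P :: "'a \<Rightarrow> real \<times> real" and Y :: "'a \<Rightarrow> nat"
  assumes "prob_space M"
    and distr: "distr M borel P = uniform_measure lborel ({0..1} \<times> {0..1})"
    and cond: "cond_distribution M (count_space UNIV) Y borel P ({0..1} \<times> {0..1})
           (\<lambda>(p1, p2). measure_pmf (binomial_pmf n (p1 * p2)))"
    and y: "y \<le> n"
  shows "posterior M P Y y = density lborel (\<lambda>p. ennreal (posterior_density n y p))"
    and "prob_space (posterior M P Y y)"
proof -
  interpret prob_space M by fact
  have [measurable]: "Y \<in> measurable M (count_space UNIV)" "P \<in> borel_measurable M"
    and P_square: "AE \<omega> in M. P \<omega> \<in> {0..1} \<times> {0..1}"
    using cond by (auto simp: cond_distribution_def)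
  let ?I = "\<integral>q. posterior_kernel n y q \<partial>lborel"
  let ?U = "{0..1} \<times> {0..1} :: (real \<times> real) set"
  let ?E = "{\<omega> \<in> space M. Y \<omega> = y}"
  define c where "c = real (n choose y)"
  have c: "0 < c"
    using y by (simp add: c_def)
  note I = integral_posterior_kernel_pos[of n y]
  have U: "emeasure lborel ?U = 1"
    unfolding lborel_prod[symmetric] by (subst lborel.emeasure_pair_measure_Times) auto
  have U_sets [measurable]: "?U \<in> sets borel"
    by (simp add: borel_prod[symmetric])
  \<comment> \<open>The likelihood as a Borel function on the whole plane. It is compared with the
    binomial probability only on the unit square, where \<open>p1 * p2\<close> is a valid success
    probability.\<close>
  define b where "b = (\<lambda>(p1, p2). ennreal (c * ((p1 * p2) ^ y * (1 - p1 * p2) ^ (n - y))))"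
  have [measurable]: "b \<in> borel_measurable borel"
    unfolding b_def borel_prod[symmetric] by measurable
  have joint: "emeasure M (?E \<inter> (P -` B \<inter> space M)) =
      ennreal c * (\<integral>\<^sup>+p. ennreal (posterior_kernel n y p) * indicator B p \<partial>lborel)"
    if [measurable]: "B \<in> sets borel" for B
  proof -
    have "?E = Y -` {y} \<inter> space M"
      by auto
    then have "emeasure M (?E \<inter> (P -` B \<inter> space M)) = (\<integral>\<^sup>+\<omega>. ennreal (measure
        ((\<lambda>(p1, p2). measure_pmf (binomial_pmf n (p1 * p2))) (P \<omega>)) {y}) * indicator B (P \<omega>) \<partial>M)"
      using cond_distribution_joint[OF finite_measure_axioms cond, of "{y}" B] that by simp
    also have "\<dots> = (\<integral>\<^sup>+\<omega>. b (P \<omega>) * indicator B (P \<omega>) \<partial>M)"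
    proof (intro nn_integral_cong_AE)
      show "AE \<omega> in M. ennreal (measure ((\<lambda>(p1, p2). measure_pmf (binomial_pmf n (p1 * p2))) (P \<omega>)) {y})
          * indicator B (P \<omega>) = b (P \<omega>) * indicator B (P \<omega>)"
        using P_square
      proof eventually_elim
        case (elim \<omega>)
        then show ?case
          by (cases "P \<omega>") (auto simp: b_def c_def measure_pmf_single mult_le_one mult_ac)
      qed
    qed
    also have "\<dots> = (\<integral>\<^sup>+p. b p * indicator B p \<partial>distr M borel P)"
      by (rule nn_integral_distr[symmetric]) measurable
    also have "\<dots> = (\<integral>\<^sup>+p. b p * indicator B p * indicator ?U p \<partial>lborel)"
      unfolding distr by (subst nn_integral_uniform_measure) (auto simp: U divide_ennreal_def)
    also have "\<dots> = (\<integral>\<^sup>+p. ennreal c * (ennreal (posterior_kernel n y p) * indicator B p) \<partial>lborel)"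
    proof (intro nn_integral_cong_AE)
      show "AE p in lborel. b p * indicator B p * indicator ?U p =
          ennreal c * (ennreal (posterior_kernel n y p) * indicator B p)"
        using AE_unit_square_interior
      proof eventually_elim
        case (elim p)
        have "b p * indicator ?U p = ennreal (c * posterior_kernel n y p)"
          using elim by (cases p) (auto simp: b_def posterior_kernel_def indicator_def)
        then have "b p * indicator ?U p * indicator B p = ennreal c * ennreal (posterior_kernel n y p) * indicator B p"
          using c posterior_kernel_nonneg[of n y p] by (simp add: ennreal_mult)
        then show ?case
          by (simp only: mult_ac)
      qed
    qed
    also have "\<dots> = ennreal c * (\<integral>\<^sup>+p. ennreal (posterior_kernel n y p) * indicator B p \<partial>lborel)"
      by (rule nn_integral_cmult) measurable
    finally show ?thesis .
  qed
  \<comment> \<open>The case \<open>B = UNIV\<close> gives the probability of \<open>Y = y\<close>;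
    it is positive, so conditioning on this event is legitimate.\<close>
  have E: "emeasure M ?E = ennreal (c * ?I)"
    using joint[of UNIV] c I nn_integral_eq_integral[OF integrable_posterior_kernel[of n y]] posterior_kernel_nonneg
    by (simp add: ennreal_mult Int_absorb2)
  have E_sets [measurable]: "?E \<in> sets M"
    by measurable
  show "posterior M P Y y = density lborel (\<lambda>p. ennreal (posterior_density n y p))"
  proof (rule measure_eqI)
    fix B assume "B \<in> sets (posterior M P Y y)"
    then have B [measurable]: "B \<in> sets borel"
      by (simp add: posterior_def)
    let ?J = "\<integral>\<^sup>+p. ennreal (posterior_kernel n y p) * indicator B p \<partial>lborel"
    have "emeasure (posterior M P Y y) B = emeasure M (?E \<inter> (P -` B \<inter> space M)) / emeasure M ?E"
      unfolding posterior_def by (subst emeasure_distr) auto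
    also have "\<dots> = (ennreal c * ?J) / (ennreal c * ennreal ?I)"
      using c I by (simp add: joint[OF B] E ennreal_mult)
    also have "\<dots> = ?J / ennreal ?I"
      using c divide_mult_eq[of "ennreal c" ?J "ennreal ?I"] by (simp add: mult.commute)
    also have "\<dots> = (\<integral>\<^sup>+p. ennreal (posterior_kernel n y p) * indicator B p / ennreal ?I \<partial>lborel)"
      by (rule nn_integral_divide[symmetric]) measurable
    also have "\<dots> = (\<integral>\<^sup>+p. ennreal (posterior_density n y p) * indicator B p \<partial>lborel)"
      using I posterior_kernel_nonneg[of n y]
      by (intro nn_integral_cong) (auto simp: posterior_density_def divide_ennreal indicator_def)
    also have "\<dots> = emeasure (density lborel (\<lambda>p. ennreal (posterior_density n y p))) B"
      by (rule emeasure_density[symmetric]) (auto simp: posterior_density_def[abs_def])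
    finally show "emeasure (posterior M P Y y) B =
        emeasure (density lborel (\<lambda>p. ennreal (posterior_density n y p))) B" .
  qed (simp add: posterior_def)
  have "prob_space (uniform_measure M ?E)"
    using E c I by (intro prob_space_uniform_measure) auto
  then show "prob_space (posterior M P Y y)"
    unfolding posterior_def by (rule prob_space.prob_space_distr) measurable
qed

section \<open>Symmetry and factorisation of the posterior\<close>

text \<open>Lebesgue measure on the plane is invariant under the swap, and the density is symmetric
  in its two arguments.\<close>

lemma distr_swap_posterior_density:
  "distr (density lborel (\<lambda>p. ennreal (posterior_density n y p))) borel (\<lambda>(p1, p2). (p2, p1)) =
    density lborel (\<lambda>p. ennreal (posterior_density n y p))"
proof -
  let ?s = "\<lambda>(p1, p2). (p2, p1) :: real \<times> real"
  let ?d = "\<lambda>p. ennreal (posterior_density n y p)"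
  have s [measurable]: "?s \<in> measurable lborel lborel" "?s \<in> measurable borel borel"
    unfolding borel_prod[symmetric] measurable_lborel1 measurable_lborel2 by measurable
  have d [measurable]: "?d \<in> borel_measurable lborel"
    unfolding posterior_density_def[abs_def] by measurable
  have swap: "distr lborel lborel ?s = lborel"
    using lborel_pair.distr_pair_swap[where ?'a = real and ?'b = real] unfolding lborel_prod by simp
  have inv: "?d (?s p) = ?d p" for p
    by (cases p) (simp add: posterior_density_def posterior_kernel_def mult_ac indicator_def conj_commute)
  have "density lborel ?d = density (distr lborel lborel ?s) ?d"
    by (simp only: swap)
  also have "\<dots> = distr (density lborel (\<lambda>p. ?d (?s p))) lborel ?s"
    by (rule density_distr) measurable
  also have "\<dots> = distr (density lborel ?d) borel ?s"
    unfolding inv by (rule distr_cong) auto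
  finally show ?thesis ..
qed

text \<open>Multiplying and dividing by the positive weighted Beta constant splits off the
  conditional density of \<open>p1\<close>; the bracketed factor becomes the marginal density of
  \<open>p2\<close>.\<close>

lemma posterior_density_factor:
  assumes "y \<le> n"
  shows "posterior_density n y (x, z) =
    (z ^ y * wbeta_const (real y + 1) (real (n - y) + 1) z / (\<integral>q. posterior_kernel n y q \<partial>lborel) *
      indicator {0<..<1} z) * wbeta_density (real y + 1) (real (n - y) + 1) z x"
proof (cases "x \<in> {0<..<1} \<and> z \<in> {0<..<1}")
  case True
  then have "wbeta_const (real y + 1) (real (n - y) + 1) z \<noteq> 0"
    using wbeta_const_pos[of z y "n - y"] by auto
  then show ?thesis
    using True wbeta_density_eq_power[of z x y "n - y"]
    by (simp add: posterior_density_def posterior_kernel_def power_mult_distrib mult_ac)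
qed (auto simp: posterior_density_def posterior_kernel_def wbeta_density_def)

section \<open>Assembling the decomposition\<close>

theorem theorem1:
  fixes M :: "'a measure" and P1 P2 :: "'a \<Rightarrow> real" and Y :: "'a \<Rightarrow> nat" and n :: nat
  assumes "n \<ge> 1"
    and "prob_space M"
    and "P1 \<in> borel_measurable M" and "P2 \<in> borel_measurable M"
    and "distr M borel (\<lambda>\<omega>. (P1 \<omega>, P2 \<omega>)) = uniform_measure lborel ({0..1} \<times> {0..1})"
    and "cond_distribution M (count_space UNIV) Y borel (\<lambda>\<omega>. (P1 \<omega>, P2 \<omega>)) ({0..1} \<times> {0..1})
           (\<lambda>(p1, p2). measure_pmf (binomial_pmf n (p1 * p2)))"
  shows "\<forall>y\<in>{0..n}.
    (let Q = posterior M (\<lambda>\<omega>. (P1 \<omega>, P2 \<omega>)) Y y in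
       Q = density lborel (\<lambda>p. ennreal (posterior_density n y p)) \<and>
       distr Q borel (\<lambda>(p1, p2). (p2, p1)) = Q \<and>
       cond_distribution Q borel fst borel snd {0..1}
         (\<lambda>p2. wbeta (real y + 1) (real n - real y + 1) p2) \<and>
       (\<exists>w :: nat \<Rightarrow> real.
          (\<forall>k\<in>{0..n - y}. w k \<ge> 0) \<and>
          (\<Sum>k=0..n - y. w k) = 1 \<and>
          (\<exists>c>0. \<forall>k\<in>{0..n - y}. w k = c * inverse (real k + real y + 1)) \<and>
          distributed Q lborel snd (\<lambda>p2. ennreal (\<Sum>k=0..n - y.
            w k * wbeta_density (real k + real y + 1) (real n - real y - real k + 1) 1 p2))))"
proof
  fix y assume "y \<in> {0..n}"
  then have y: "y \<le> n"
    by simp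
  define q where "q = n - y"
  have q: "real n - real y = real q"
    using y by (simp add: q_def of_nat_diff)
  define Q where "Q = posterior M (\<lambda>\<omega>. (P1 \<omega>, P2 \<omega>)) Y y"
  note posterior = posterior_eq_density[OF assms(2,5,6) y, folded Q_def]
  interpret Q: prob_space Q
    by (rule posterior(2))
  define I where "I = (\<integral>q. posterior_kernel n y q \<partial>lborel)"
  have I: "0 < I"
    unfolding I_def by (rule integral_posterior_kernel_pos)
  define h where "h z = z ^ y * wbeta_const (real y + 1) (real q + 1) z / I * indicator {0<..<1} z" for z
  define f where "f z x = wbeta_density (real y + 1) (real q + 1) z x" for z x
  have h_nonneg: "0 \<le> h z" for z
    using I wbeta_const_pos[of z y q] by (auto simp: h_def indicator_def)
  have h_zero: "h z = 0" if "z \<notin> {0..1}" for z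
    using that by (auto simp: h_def)
  have [measurable]: "h \<in> borel_measurable borel"
    unfolding h_def by measurable
  have Q_eq: "Q = density lborel (\<lambda>(x, z). ennreal (h z) * ennreal (f z x))"
    unfolding posterior(1)
  proof (intro arg_cong2[where f=density] ext refl)
    fix p :: "real \<times> real"
    obtain x z where p: "p = (x, z)"
      by (cases p)
    have "posterior_density n y p = h z * f z x"
      unfolding p posterior_density_factor[OF y] h_def f_def I_def q_def ..
    then show "ennreal (posterior_density n y p) = (case p of (x, z) \<Rightarrow> ennreal (h z) * ennreal (f z x))"
      using ennreal_mult'[OF h_nonneg[of z], of "f z x"] by (simp add: p)
  qed
  have f_meas: "(\<lambda>(z, x). ennreal (f z x)) \<in> borel_measurable (borel \<Otimes>\<^sub>M borel)"
    unfolding f_def by measurable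
  have f_one: "(\<integral>\<^sup>+x. ennreal (f z x) \<partial>lborel) = 1" if "z \<in> {0..1}" for z
    using that nn_integral_wbeta_density[of z y q] by (simp add: f_def)
  note factor = posterior(2) Q_eq f_meas _ _ f_one
  have cond: "cond_distribution Q borel fst borel snd {0..1} (\<lambda>z. density lborel (\<lambda>x. ennreal (f z x)))"
    by (rule cond_distribution_density_factor[OF factor]) (auto simp: h_zero)
  have marginal: "distr Q lborel snd = density lborel (\<lambda>z. ennreal (h z))"
    by (rule distr_snd_density_factor[OF factor, where S = "{0..1}"]) (auto simp: h_zero)
  \<comment> \<open>The factor that \<open>wbeta_const_mixture\<close> produces at
    \<open>m = y\<close>, where \<open>m + q = n\<close>, divided by the normalising integral
    \<open>I\<close>.\<close>
  define c where "c = 1 / (I * (real (Suc n) * real (n choose y)))"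
  have c: "0 < c"
    using I y by (simp add: c_def del: of_nat_Suc)
  define w where "w k = c * inverse (real k + real y + 1)" for k
  have w_nonneg: "0 \<le> w k" for k
    using c by (simp add: w_def)
  define d where "d k z = wbeta_density (real (k + y) + 1) (real (q - k) + 1) 1 z" for k z
  have d_nonneg: "0 \<le> d k z" for k z
    unfolding d_def by (rule wbeta_density_nonneg) auto
  have d_one: "(\<integral>\<^sup>+z. ennreal (d k z) \<partial>lborel) = 1" for k
    unfolding d_def by (rule nn_integral_wbeta_density) auto
  have [measurable]: "d k \<in> borel_measurable borel" for k
    unfolding d_def by measurable
  have h_eq: "h z = (\<Sum>k=0..q. w k * d k z)" for z
  proof (cases "z \<in> {0<..<1}")
    case True
    have "y + q = n"
      using y by (simp add: q_def)
    then have "h z = c * (\<Sum>k=0..q. inverse (real k + real y + 1) * d k z)"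
      using True wbeta_const_mixture[OF True, of y q]
      by (simp add: h_def d_def c_def mult.commute del: of_nat_Suc of_nat_add)
    then show ?thesis
      by (simp add: w_def sum_distrib_left mult.assoc)
  qed (simp add: h_def d_def wbeta_density_def)
  \<comment> \<open>No evaluation of \<open>I\<close> is required: every component density has mass
    1, so the sum of the weights is the mass of the mixture, which is the marginal of a probability
    measure.\<close>
  have "ennreal (\<Sum>k=0..q. w k) = (\<Sum>k=0..q. ennreal (w k) * (\<integral>\<^sup>+z. ennreal (d k z) \<partial>lborel))"
    using w_nonneg by (simp add: d_one)
  also have "\<dots> = (\<integral>\<^sup>+z. (\<Sum>k=0..q. ennreal (w k) * ennreal (d k z)) \<partial>lborel)"
    by (simp add: nn_integral_sum nn_integral_cmult)
  also have "\<dots> = (\<integral>\<^sup>+z. ennreal (h z) \<partial>lborel)"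
    using w_nonneg d_nonneg by (intro nn_integral_cong) (simp add: h_eq flip: ennreal_mult)
  also have "\<dots> = emeasure (distr Q lborel snd) UNIV"
    unfolding marginal by (simp add: emeasure_density)
  also have "\<dots> = 1"
  proof -
    have "snd \<in> measurable Q lborel"
      by (simp add: Q_eq flip: borel_prod)
    then show ?thesis
      using Q.emeasure_space_1 by (simp add: emeasure_distr)
  qed
  finally have w_sum: "(\<Sum>k=0..q. w k) = 1"
    using w_nonneg by (simp add: sum_nonneg)
  have mixture: "(\<Sum>k=0..q. w k * wbeta_density (real k + real y + 1) (real n - real y - real k + 1) 1 z) = h z" for z
    unfolding h_eq
  proof (intro sum.cong refl)
    \<comment> \<open>Since \<open>k \<le> q\<close>, the truncated difference \<open>q - k\<close>
      agrees with the real difference.\<close>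
    fix k assume "k \<in> {0..q}"
    then show "w k * wbeta_density (real k + real y + 1) (real n - real y - real k + 1) 1 z = w k * d k z"
      by (simp add: d_def q of_nat_diff)
  qed
  have distributed: "distributed Q lborel snd (\<lambda>z. ennreal (h z))"
    using marginal by (simp add: distributed_def) (simp add: Q_eq flip: borel_prod)
  show "let Q = posterior M (\<lambda>\<omega>. (P1 \<omega>, P2 \<omega>)) Y y in
       Q = density lborel (\<lambda>p. ennreal (posterior_density n y p)) \<and>
       distr Q borel (\<lambda>(p1, p2). (p2, p1)) = Q \<and>
       cond_distribution Q borel fst borel snd {0..1}
         (\<lambda>p2. wbeta (real y + 1) (real n - real y + 1) p2) \<and>
       (\<exists>w :: nat \<Rightarrow> real.
          (\<forall>k\<in>{0..n - y}. w k \<ge> 0) \<and>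
          (\<Sum>k=0..n - y. w k) = 1 \<and>
          (\<exists>c>0. \<forall>k\<in>{0..n - y}. w k = c * inverse (real k + real y + 1)) \<and>
          distributed Q lborel snd (\<lambda>p2. ennreal (\<Sum>k=0..n - y.
            w k * wbeta_density (real k + real y + 1) (real n - real y - real k + 1) 1 p2)))"
    unfolding Let_def Q_def[symmetric] q_def[symmetric]
  proof (intro conjI exI[of _ w])
    show "Q = density lborel (\<lambda>p. ennreal (posterior_density n y p))"
      by (rule posterior(1))
    show "distr Q borel (\<lambda>(p1, p2). (p2, p1)) = Q"
      unfolding posterior(1) by (rule distr_swap_posterior_density)
    show "cond_distribution Q borel fst borel snd {0..1} (\<lambda>p2. wbeta (real y + 1) (real n - real y + 1) p2)"
      unfolding wbeta_def q using cond unfolding f_def .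
    show "\<forall>k\<in>{0..q}. 0 \<le> w k"
      using w_nonneg by blast
    show "(\<Sum>k=0..q. w k) = 1"
      by (rule w_sum)
    show "\<exists>c>0. \<forall>k\<in>{0..q}. w k = c * inverse (real k + real y + 1)"
      using c unfolding w_def by blast
    show "distributed Q lborel snd (\<lambda>p2. ennreal (\<Sum>k=0..q.
            w k * wbeta_density (real k + real y + 1) (real n - real y - real k + 1) 1 p2))"
      unfolding mixture by (rule distributed)
  qed
qed

end
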